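(* Let $X$ be a Hausdorff locally convex space over $\mathbb R$ and let $(U_n)_{n\in\mathbb N}$ be a (countable) base of neighborhoods of zero in $X$. Then the following conditions are equivalent: (1) $X$ is normable; (2) for any sequence $(A_n)_{n\in\mathbb N}$ of nowhere dense convex sets in $X$, the intersection $\bigcap_{n\in\mathbb N}(A_n+U_n)$ is nowhere dense in $X$; (3) for any sequence $(L_n)_{n\in\mathbb N}$ of nowhere dense linear subspaces of $X$, the intersection $\bigcap_{n\in\mathbb N}(L_n+U_n)$ is not equal to $X$.
   Context: A locally convex space means a locally convex linear topological space over the field of real numbers. It is normable if its topology is generated by a norm. A base of neighborhoods of zero is a family of neighborhoods of $0$ such that every neighborhood of $0$ contains a member of the family; the sets $U_n$ are not assumed to be convex, symmetric, or decreasing in $n$. For subsets $S,U\subset X$, $S+U=\{s+u: s\in S,\ u\in U\}$. A subset of a topological space is nowhere dense if its closure has empty interior. *)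

theory Defs
  imports "HOL-Analysis.Analysis"
begin

class real_topological_vector = real_vector + topological_ab_group_add +
  assumes tendsto_scaleR_nhds:
    "((\<lambda>p. fst p *\<^sub>R snd p) \<longlongrightarrow> c *\<^sub>R x) (nhds c \<times>\<^sub>F nhds x)"

instance real_normed_vector < real_topological_vector
  by standard (intro tendsto_scaleR filterlim_fst filterlim_snd)

text \<open>
  Neighborhoods need not be open: \<open>V\<close> is a neighborhood of \<open>0\<close> iff \<open>0 \<in> interior V\<close>.
  Hausdorffness is not included; it is expressed by the additional sort \<open>t2_space\<close>.
\<close>

definition locally_convex :: "'a::real_topological_vector itself \<Rightarrow> bool" where
  "locally_convex _ \<longleftrightarrow>
     (\<forall>V :: 'a set. 0 \<in> interior V \<longrightarrow> (\<exists>C. convex C \<and> 0 \<in> interior C \<and> C \<subseteq> V))"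

lemma locally_convex_real_normed_vector: "locally_convex TYPE('a::real_normed_vector)"
  unfolding locally_convex_def
proof (intro allI impI)
  fix V :: "'a set"
  assume "0 \<in> interior V"
  then obtain e where "e > 0" "ball 0 e \<subseteq> V"
    by (auto simp: mem_interior)
  then show "\<exists>C. convex C \<and> 0 \<in> interior C \<and> C \<subseteq> V"
    by (intro exI[of _ "ball 0 e"]) auto
qed

definition is_norm :: "('a::real_vector \<Rightarrow> real) \<Rightarrow> bool" where
  "is_norm N \<longleftrightarrow>
     (\<forall>x. 0 \<le> N x) \<and>
     (\<forall>x. N x = 0 \<longleftrightarrow> x = 0) \<and>
     (\<forall>c x. N (c *\<^sub>R x) = \<bar>c\<bar> * N x) \<and>
     (\<forall>x y. N (x + y) \<le> N x + N y)"

definition normable :: "'a::{real_vector, topological_space} itself \<Rightarrow> bool" where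
  "normable _ \<longleftrightarrow>
     (\<exists>N :: 'a \<Rightarrow> real. is_norm N \<and>
        (\<forall>S. open S \<longleftrightarrow> (\<forall>x\<in>S. \<exists>e>0. \<forall>y. N (y - x) < e \<longrightarrow> y \<in> S)))"

definition nowhere_dense :: "'a::topological_space set \<Rightarrow> bool" where
  "nowhere_dense S \<longleftrightarrow> interior (closure S) = {}"

definition zero_nhd_base :: "(nat \<Rightarrow> 'a::{zero, topological_space} set) \<Rightarrow> bool" where
  "zero_nhd_base U \<longleftrightarrow>
     (\<forall>n. 0 \<in> interior (U n)) \<and>
     (\<forall>V. 0 \<in> interior V \<longrightarrow> (\<exists>n. U n \<subseteq> V))"

end

theory Submission
  imports Defs
begin

text \<open>
  If \<open>X\<close> is normed and \<open>\<Inter>\<^sub>n (A\<^sub>n + U\<^sub>n)\<close> is dense in a ball of radius \<open>r\<close>, then for a single \<open>n\<close> with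
  \<open>U\<^sub>n\<close> inside the ball of radius \<open>r / 3\<close>, the cancellation law for convex sets makes \<open>A\<^sub>n\<close> dense
  in the concentric ball of radius \<open>r / 3\<close>. If \<open>X\<close> is not normable, then no symmetric convex
  neighbourhood \<open>V\<close> of zero is bounded, so some continuous functional \<open>f\<close> is unbounded on \<open>V\<close>;
  hence \<open>f(V)\<close> is all of \<open>\<real>\<close> and \<open>ker f + V = X\<close>. Choosing such a kernel for
  each \<open>U\<^sub>n\<close> violates the condition on subspaces.
\<close>

section \<open>Linear functionals below a sublinear functional\<close>

definition sublinear :: "('a::real_vector \<Rightarrow> real) \<Rightarrow> bool" where
  "sublinear p \<longleftrightarrow>
     (\<forall>x y. p (x + y) \<le> p x + p y) \<and> (\<forall>t x. 0 \<le> t \<longrightarrow> p (t *\<^sub>R x) = t * p x)"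

lemma sublinear_add: "sublinear p \<Longrightarrow> p (x + y) \<le> p x + p y"
  and sublinear_scaleR: "sublinear p \<Longrightarrow> 0 \<le> t \<Longrightarrow> p (t *\<^sub>R x) = t * p x"
  by (auto simp: sublinear_def)

lemma sublinear_zero: "sublinear p \<Longrightarrow> p 0 = 0"
  using sublinear_scaleR[of p 0 0] by simp

lemma sublinear_minus: "sublinear p \<Longrightarrow> - p (- x) \<le> p x"
  using sublinear_add[of p x "- x"] by (simp add: sublinear_zero)

text \<open>The homogeneity bound with factor \<open>1 / t\<close>, applied at
  \<open>t *\<^sub>R x\<close>, is the reverse inequality. An upper estimate is therefore enough,
  which suits functionals given by infima.\<close>

lemma sublinearI:
  assumes "\<And>x y. p (x + y) \<le> p x + p y"
    and le: "\<And>t x. 0 < t \<Longrightarrow> p (t *\<^sub>R x) \<le> t * p x"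
    and "p 0 = 0"
  shows "sublinear p"
proof -
  have "p (t *\<^sub>R x) = t * p x" if "0 < t" for t x
  proof (rule antisym)
    have "p ((1 / t) *\<^sub>R (t *\<^sub>R x)) \<le> (1 / t) * p (t *\<^sub>R x)"
      using that by (intro le) simp
    then show "t * p x \<le> p (t *\<^sub>R x)"
      using that by (simp add: field_simps)
  qed (use le that in blast)
  then show ?thesis
    using assms by (auto simp: sublinear_def le_less)
qed

text \<open>For sublinear \<open>q\<close> this is the largest sublinear functional below
  \<open>q\<close> whose value at \<open>- a\<close> is at most \<open>- q a\<close>. A linear
  functional below it must agree with \<open>q\<close> at \<open>a\<close>.\<close>

definition tilt :: "('a::real_vector \<Rightarrow> real) \<Rightarrow> 'a \<Rightarrow> 'a \<Rightarrow> real" where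
  "tilt q a x = (INF t\<in>{0..}. q (x + t *\<^sub>R a) - t * q a)"

lemma tilt_lower:
  assumes "sublinear q" "0 \<le> t"
  shows "tilt q a x \<le> q (x + t *\<^sub>R a) - t * q a"
  unfolding tilt_def
proof (rule cINF_lower)
  \<comment> \<open>Subadditivity for \<open>s *\<^sub>R a\<close>, split as
    \<open>x + s *\<^sub>R a\<close> plus \<open>- x\<close>, bounds the family below independently
    of \<open>s\<close>, so the infimum is a genuine one.\<close>
  have "- q (- x) \<le> q (x + s *\<^sub>R a) - s * q a" if "0 \<le> s" for s
    using sublinear_add[OF assms(1), of "x + s *\<^sub>R a" "- x"]
      sublinear_scaleR[OF assms(1) that, of a] by simp
  then show "bdd_below ((\<lambda>t. q (x + t *\<^sub>R a) - t * q a) ` {0..})"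
    by (intro bdd_belowI[of _ "- q (- x)"]) auto
qed (use assms in auto)

lemma tilt_greatest:
  "(\<And>t. 0 \<le> t \<Longrightarrow> m \<le> q (x + t *\<^sub>R a) - t * q a) \<Longrightarrow> m \<le> tilt q a x"
  unfolding tilt_def by (rule cINF_greatest) auto

lemma tilt_le: "sublinear q \<Longrightarrow> tilt q a x \<le> q x"
  using tilt_lower[of q 0 a x] by simp

lemma tilt_uminus_le: "sublinear q \<Longrightarrow> tilt q a (- a) \<le> - q a"
  using tilt_lower[of q 1 a "- a"] by (simp add: sublinear_zero)

lemma sublinear_tilt:
  assumes q: "sublinear q"
  shows "sublinear (tilt q a)"
proof (rule sublinearI)
  fix x y
  \<comment> \<open>Parameters \<open>s\<close> for \<open>x\<close> and \<open>t\<close> for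
    \<open>y\<close> are merged into the admissible parameter \<open>s + t\<close> for
    \<open>x + y\<close>; the two infima are then taken one after the other.\<close>
  have *: "tilt q a (x + y) \<le> (q (x + s *\<^sub>R a) - s * q a) + (q (y + t *\<^sub>R a) - t * q a)"
    if "0 \<le> s" "0 \<le> t" for s t
    using tilt_lower[OF q, of "s + t" a "x + y"] that
      sublinear_add[OF q, of "x + s *\<^sub>R a" "y + t *\<^sub>R a"]
    by (simp add: algebra_simps)
  have "tilt q a (x + y) - (q (y + t *\<^sub>R a) - t * q a) \<le> tilt q a x" if "0 \<le> t" for t
    by (rule tilt_greatest) (use *[OF _ that] in fastforce)
  then have "tilt q a (x + y) - tilt q a x \<le> tilt q a y"
    by (intro tilt_greatest) fastforce
  then show "tilt q a (x + y) \<le> tilt q a x + tilt q a y"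
    by simp
next
  fix c :: real and x
  assume c: "0 < c"
  have "tilt q a (c *\<^sub>R x) / c \<le> tilt q a x"
  proof (rule tilt_greatest)
    fix t :: real
    assume t: "0 \<le> t"
    \<comment> \<open>Rescaling the parameter to \<open>c * t\<close> allows \<open>c\<close> to be
      factored out of the argument of \<open>q\<close>.\<close>
    have "tilt q a (c *\<^sub>R x) \<le> q (c *\<^sub>R x + (c * t) *\<^sub>R a) - (c * t) * q a"
      using c t by (intro tilt_lower[OF q]) simp
    also have "c *\<^sub>R x + (c * t) *\<^sub>R a = c *\<^sub>R (x + t *\<^sub>R a)"
      by (simp add: scaleR_add_right)
    also have "q (c *\<^sub>R (x + t *\<^sub>R a)) = c * q (x + t *\<^sub>R a)"
      using c by (intro sublinear_scaleR[OF q]) simp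
    finally show "tilt q a (c *\<^sub>R x) / c \<le> q (x + t *\<^sub>R a) - t * q a"
      using c by (simp add: field_simps)
  qed
  then show "tilt q a (c *\<^sub>R x) \<le> c * tilt q a x"
    using c by (simp add: field_simps)
next
  show "tilt q a 0 = 0"
    using tilt_le[OF q, of a 0] sublinear_scaleR[OF q, of _ a]
    by (intro antisym tilt_greatest) (simp_all add: sublinear_zero[OF q])
qed

text \<open>Supplies the lower bounds of chains for Zorn's lemma. The common bound \<open>p\<close>
  forces \<open>f x\<close> to be at least \<open>- p (- x)\<close>, so the infima are finite.
  Subadditivity needs one member below both \<open>f\<close> and \<open>g\<close>, and in a chain
  one of the two serves.\<close>

lemma sublinear_INF_chain:
  assumes "C \<noteq> {}"
    and sub: "\<And>f. f \<in> C \<Longrightarrow> sublinear f"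
    and bdd: "\<And>f. f \<in> C \<Longrightarrow> f \<le> p"
    and chain: "\<And>f g. f \<in> C \<Longrightarrow> g \<in> C \<Longrightarrow> f \<le> g \<or> g \<le> f"
  shows "sublinear (\<lambda>x. INF f\<in>C. f x)" and "\<And>f x. f \<in> C \<Longrightarrow> (INF f\<in>C. f x) \<le> f x"
proof -
  have lower: "(INF f\<in>C. f x) \<le> f x" if "f \<in> C" for f x
  proof (rule cINF_lower[OF _ that])
    have "- p (- x) \<le> f x" if "f \<in> C" for f
      using sublinear_minus[OF sub[OF that], of x] le_funD[OF bdd[OF that], of "- x"] by simp
    then show "bdd_below ((\<lambda>f. f x) ` C)"
      by (intro bdd_belowI[of _ "- p (- x)"]) auto
  qed
  show "(INF f\<in>C. f x) \<le> f x" if "f \<in> C" for f x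
    by (rule lower[OF that])
  show "sublinear (\<lambda>x. INF f\<in>C. f x)"
  proof (rule sublinearI)
    fix x y
    have *: "(INF f\<in>C. f (x + y)) \<le> f x + g y" if fg: "f \<in> C" "g \<in> C" for f g
    proof -
      obtain m where m: "m \<in> C" "m \<le> f" "m \<le> g"
        using chain[OF fg] fg by blast
      have "(INF f\<in>C. f (x + y)) \<le> m x + m y"
        using lower[OF m(1)] sublinear_add[OF sub[OF m(1)]] order_trans by blast
      also have "\<dots> \<le> f x + g y"
        using m by (intro add_mono) (auto simp: le_fun_def)
      finally show ?thesis .
    qed
    have "(INF f\<in>C. f (x + y)) - g y \<le> (INF f\<in>C. f x)" if "g \<in> C" for g
      by (rule cINF_greatest[OF assms(1)]) (use *[OF _ that] in fastforce)
    then have "(INF f\<in>C. f (x + y)) - (INF f\<in>C. f x) \<le> (INF f\<in>C. f y)"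
      by (intro cINF_greatest[OF assms(1)]) fastforce
    then show "(INF f\<in>C. f (x + y)) \<le> (INF f\<in>C. f x) + (INF f\<in>C. f y)"
      by simp
  next
    fix t :: real and x
    assume t: "0 < t"
    have "(INF f\<in>C. f (t *\<^sub>R x)) / t \<le> (INF f\<in>C. f x)"
    proof (rule cINF_greatest[OF assms(1)])
      fix f assume f: "f \<in> C"
      show "(INF f\<in>C. f (t *\<^sub>R x)) / t \<le> f x"
        using lower[OF f, of "t *\<^sub>R x"] sublinear_scaleR[OF sub[OF f], of t x] t
        by (simp add: field_simps)
    qed
    then show "(INF f\<in>C. f (t *\<^sub>R x)) \<le> t * (INF f\<in>C. f x)"
      using t by (simp add: field_simps)
  next
    have "(\<lambda>f. f 0) ` C = {0}"
      using assms(1) sub sublinear_zero by fastforce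
    then show "(INF f\<in>C. f 0) = 0"
      by simp
  qed
qed

section \<open>The Hahn-Banach theorem and functionals unbounded on a set\<close>

text \<open>Hahn--Banach: a pointwise minimal sublinear functional agrees with all its tilts, which
  forces it to be additive.\<close>

lemma sublinear_dominates_linear:
  fixes p :: "'a::real_vector \<Rightarrow> real"
  assumes p: "sublinear p"
  obtains f where "linear f" "f \<le> p"
proof -
  let ?A = "{q. sublinear q \<and> q \<le> p}"
  \<comment> \<open>The order is reversed, so that a maximal element from Zorn's lemma is a minimal
    sublinear functional.\<close>
  let ?P = "\<lambda>f g :: 'a \<Rightarrow> real. g \<le> f"
  have "\<exists>m\<in>?A. \<forall>a\<in>?A. ?P m a \<longrightarrow> a = m"
  proof (rule predicate_Zorn)
    show "partial_order_on ?A (relation_of ?P ?A)"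
      by (rule partial_order_on_relation_ofI) auto
    fix C assume C: "C \<in> Chains (relation_of ?P ?A)"
    then have CA: "C \<subseteq> ?A" and chain: "\<And>f g. f \<in> C \<Longrightarrow> g \<in> C \<Longrightarrow> f \<le> g \<or> g \<le> f"
      by (auto simp: Chains_def relation_of_def)
    show "\<exists>u\<in>?A. \<forall>a\<in>C. ?P a u"
    proof (cases "C = {}")
      case False
      have I: "sublinear (\<lambda>x. INF f\<in>C. f x)" "\<And>f x. f \<in> C \<Longrightarrow> (INF f\<in>C. f x) \<le> f x"
        using sublinear_INF_chain[OF False, of p] CA chain by blast+
      obtain f where f: "f \<in> C"
        using False by blast
      then have "(\<lambda>x. INF f\<in>C. f x) \<le> f"
        using I(2) by (auto simp: le_fun_def)
      also have "f \<le> p"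
        using f CA by blast
      finally show ?thesis
        using I by (intro bexI[of _ "\<lambda>x. INF f\<in>C. f x"]) (auto simp: le_fun_def)
    qed (use p in auto)
  qed
  then obtain q where q: "sublinear q" "q \<le> p"
    and min: "\<And>a. sublinear a \<Longrightarrow> a \<le> p \<Longrightarrow> a \<le> q \<Longrightarrow> a = q"
    by blast
  have add: "q (x + a) = q x + q a" for x a
  proof (rule antisym)
    have "tilt q a \<le> q"
      using tilt_le[OF q(1)] by (auto simp: le_fun_def)
    then have "tilt q a = q"
      using min sublinear_tilt[OF q(1)] q(2) order_trans by blast
    then have "q x \<le> q (x + 1 *\<^sub>R a) - 1 * q a"
      using tilt_lower[OF q(1), of 1 a x] by simp
    then show "q x + q a \<le> q (x + a)"
      by simp
  qed (rule sublinear_add[OF q(1)])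
  have neg: "q (- x) = - q x" for x
    using add[of x "- x"] sublinear_zero[OF q(1)] by simp
  have "q (t *\<^sub>R x) = t * q x" for t x
  proof (cases "0 \<le> t")
    case False
    then show ?thesis
      using sublinear_scaleR[OF q(1), of "- t" x] neg[of "t *\<^sub>R x"] by simp
  qed (use sublinear_scaleR[OF q(1)] in simp)
  then have "linear q"
    using add by (intro linearI) auto
  then show ?thesis
    using that q(2) by blast
qed

text \<open>Hahn-Banach is applied to \<open>tilt p v\<close> instead of \<open>p\<close>: its value
  at \<open>- v\<close> is at most \<open>- p v\<close>, which forces \<open>f v = p v\<close>.
  Symmetry of \<open>p\<close> turns the one-sided bound into a bound on the absolute value.\<close>

lemma norming_functional:
  assumes p: "sublinear p" and sym: "\<And>x. p (- x) = p x"
  obtains f where "linear f" "\<And>x. \<bar>f x\<bar> \<le> p x" "f v = p v"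
proof -
  obtain f where f: "linear f" "f \<le> tilt p v"
    using sublinear_dominates_linear[OF sublinear_tilt[OF p]] by blast
  have le: "f x \<le> p x" for x
    using le_funD[OF f(2), of x] tilt_le[OF p, of v x] by simp
  have neg: "f (- x) = - f x" for x
    using linear_neg[OF f(1)] .
  have "\<bar>f x\<bar> \<le> p x" for x
    using le[of x] le[of "- x"] by (simp add: neg sym)
  moreover have "f v = p v"
    using le_funD[OF f(2), of "- v"] tilt_uminus_le[OF p, of v] neg[of v] le[of v] by simp
  ultimately show ?thesis
    using that f(1) by blast
qed

text \<open>A gliding hump: \<open>f = (\<Sum>k. \<plusminus> 3^-(k+1) g\<^sub>k)\<close>, where \<open>g\<^sub>k\<close> norms \<open>v\<^sub>k\<close> and the sign prevents
  cancellation with the preceding terms at \<open>v\<^sub>k\<close>; the later terms contribute at most half of the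
  \<open>k\<close>-th one there.\<close>

lemma unbounded_functional:
  fixes p :: "'a::real_vector \<Rightarrow> real"
  assumes p: "sublinear p" and sym: "\<And>x. p (- x) = p x"
    and unbdd: "\<And>M. \<exists>v\<in>V. M < p v"
  obtains f where "linear f" "\<And>x. \<bar>f x\<bar> \<le> p x" "\<And>M. \<exists>v\<in>V. M < \<bar>f v\<bar>"
proof -
  \<comment> \<open>Growth \<open>4 ^ k\<close> beats the weights \<open>(1 / 3) ^ Suc k\<close>
    used below: their product is a third of \<open>(4 / 3) ^ k\<close>, which is unbounded.\<close>
  have "\<exists>v. v \<in> V \<and> 4 ^ k < p v" for k :: nat
    using unbdd by blast
  then obtain v where v: "\<And>k. v k \<in> V" "\<And>k :: nat. 4 ^ k < p (v k)"
    by metis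
  have "\<exists>g. linear g \<and> (\<forall>x. \<bar>g x\<bar> \<le> p x) \<and> g (v k) = p (v k)" for k
    using norming_functional[OF p sym] by metis
  then obtain g where lin: "\<And>k. linear (g k)" and le: "\<And>k x. \<bar>g k x\<bar> \<le> p x"
    and norming: "\<And>k. g k (v k) = p (v k)"
    by metis
  define r :: "nat \<Rightarrow> real" where "r k = (1 / 3) ^ Suc k" for k
  \<comment> \<open>The partial sums are defined by recursion because the sign of each new term
    depends on the value of the previous partial sum at \<open>v k\<close>.\<close>
  define F where "F = rec_nat (\<lambda>x. 0)
    (\<lambda>k Fk x. Fk x + (if Fk (v k) \<ge> 0 then 1 else - 1) * r k * g k x)"
  define c where "c k = (if F k (v k) \<ge> 0 then 1 else - 1) * r k" for k
  have F_Suc: "F (Suc k) x = F k x + c k * g k x" for k x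
    by (simp add: F_def c_def)
  have F_sum: "F n x = (\<Sum>k<n. c k * g k x)" for n x
    by (induction n) (simp_all add: F_Suc, simp add: F_def)
  have p0: "0 \<le> p x" for x
    using le[of 0 x] by linarith
  have term_le: "\<bar>c k * g k x\<bar> \<le> r k * p x" for k x
    using le[of k x] by (auto simp: c_def r_def abs_mult intro!: mult_left_mono)
  have geo: "(\<lambda>j. r (j + n) * p x) sums ((1 / 3) ^ n / 2 * p x)" for n x
  proof -
    have "(\<lambda>j. (1 / 3) ^ Suc n * (1 / 3 :: real) ^ j) sums ((1 / 3) ^ Suc n * (1 / (1 - 1 / 3)))"
      by (intro sums_mult geometric_sums) simp
    then have "(\<lambda>j. r (j + n)) sums ((1 / 3) ^ n / 2)"
      by (simp add: r_def power_add mult_ac)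
    then show ?thesis
      by (rule sums_mult2)
  qed
  have summ: "summable (\<lambda>k. c k * g k x)" for x
  proof (rule summable_comparison_test')
    show "summable (\<lambda>k. r k * p x)"
      using sums_summable[OF geo[of 0 x]] by simp
    show "norm (c k * g k x) \<le> r k * p x" for k
      using term_le by simp
  qed
  define f where "f x = (\<Sum>k. c k * g k x)" for x
  \<comment> \<open>For \<open>n = 0\<close> this bounds \<open>f\<close> by \<open>p\<close>; for
    \<open>n = Suc k\<close> the right-hand side is half of \<open>r k * p x\<close>.\<close>
  have tail: "\<bar>f x - F n x\<bar> \<le> (1 / 3) ^ n / 2 * p x" for n x
  proof -
    have "f x - F n x = (\<Sum>j. c (j + n) * g (j + n) x)"
      using suminf_split_initial_segment[OF summ, of x n] by (simp add: f_def F_sum)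
    moreover have "norm (\<Sum>j. c (j + n) * g (j + n) x) \<le> (\<Sum>j. r (j + n) * p x)"
      by (rule norm_suminf_le) (use term_le sums_summable[OF geo[of n x]] in simp_all)
    ultimately show ?thesis
      using sums_unique[OF geo[of n x]] by simp
  qed
  show ?thesis
  proof
    show "linear f"
    proof (rule linearI)
      show "f (x + y) = f x + f y" for x y
        using suminf_add[OF summ[of x] summ[of y]]
        by (simp add: f_def linear_add[OF lin] distrib_left)
      show "f (t *\<^sub>R x) = t *\<^sub>R f x" for t x
        using suminf_mult[OF summ[of x], of t]
        by (simp add: f_def linear_scale[OF lin] mult_ac)
    qed
    show "\<bar>f x\<bar> \<le> p x" for x
      using tail[of x 0] p0[of x] by (simp add: F_sum)
    fix M
    \<comment> \<open>The factor 6 collects a 2 from the half of the \<open>k\<close>-th term that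
      survives the tail and a 3 from \<open>r k * 4 ^ k = (4 / 3) ^ k / 3\<close>.\<close>
    obtain k where k: "6 * M < (4 / 3 :: real) ^ k"
      using real_arch_pow[of "4 / 3" "6 * M"] by auto
    have rp: "0 \<le> r k * p (v k)"
      using p0 by (simp add: r_def)
    have "\<bar>F (Suc k) (v k)\<bar> \<ge> r k * p (v k)"
    proof (cases "F k (v k) \<ge> 0")
      case True
      then show ?thesis
        using True rp by (simp add: F_Suc c_def norming)
    next
      case False
      then show ?thesis
        using False rp by (simp add: F_Suc c_def norming)
    qed
    moreover have "\<bar>f (v k) - F (Suc k) (v k)\<bar> \<le> r k / 2 * p (v k)"
      using tail[of "v k" "Suc k"] by (simp add: r_def)
    ultimately have "r k * p (v k) / 2 \<le> \<bar>f (v k)\<bar>"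
      by (simp add: abs_if split: if_splits)
    moreover have "r k * 4 ^ k < r k * p (v k)"
      using v(2)[of k] by (simp add: r_def)
    moreover have "r k * 4 ^ k = (4 / 3) ^ k / 3"
      by (simp add: r_def power_divide)
    ultimately have "M < \<bar>f (v k)\<bar>"
      using k by linarith
    then show "\<exists>v\<in>V. M < \<bar>f v\<bar>"
      using v(1) by blast
  qed
qed

section \<open>Neighbourhoods and Minkowski functionals\<close>

lemma tendsto_scaleR_left_nhds:
  fixes x :: "'a::real_topological_vector"
  shows "((\<lambda>t. t *\<^sub>R x) \<longlongrightarrow> c *\<^sub>R x) (nhds c)"
proof -
  have "filterlim (\<lambda>t. (t, x)) (nhds c \<times>\<^sub>F nhds x) (nhds c)"
    by (intro filterlim_Pair filterlim_ident) simp
  from filterlim_compose[OF tendsto_scaleR_nhds this] show ?thesis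
    by simp
qed

lemma continuous_on_scaleR_right:
  "continuous_on UNIV (\<lambda>x :: 'a::real_topological_vector. c *\<^sub>R x)"
proof -
  have "((\<lambda>y. c *\<^sub>R y) \<longlongrightarrow> c *\<^sub>R x) (at x)" for x :: 'a
  proof -
    have "filterlim (\<lambda>y. (c, y)) (nhds c \<times>\<^sub>F nhds x) (at x)"
      by (intro filterlim_Pair tendsto_ident_at) simp
    from filterlim_compose[OF tendsto_scaleR_nhds this] show ?thesis
      by simp
  qed
  then show ?thesis
    by (simp add: continuous_on_def)
qed

text \<open>Continuity of scalar multiplication in the scalar sends \<open>y + t *\<^sub>R x\<close>
  to \<open>y\<close> as \<open>t\<close> tends to 0. With \<open>y = 0\<close> it makes
  neighbourhoods absorbing; with general \<open>y\<close> it shows that kernels have no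
  interior.\<close>

lemma small_multiple:
  fixes x y :: "'a::real_topological_vector"
  assumes "y \<in> interior V"
  obtains t where "0 < t" "y + t *\<^sub>R x \<in> V"
proof -
  have "((\<lambda>t. y + t *\<^sub>R x) \<longlongrightarrow> y + 0 *\<^sub>R x) (nhds 0)"
    by (intro tendsto_add tendsto_scaleR_left_nhds) simp
  then have "\<forall>\<^sub>F t in nhds 0. y + t *\<^sub>R x \<in> interior V"
    using assms by (auto dest: topological_tendstoD)
  then obtain e where "e > 0" "\<And>t :: real. dist t 0 < e \<Longrightarrow> y + t *\<^sub>R x \<in> interior V"
    by (auto simp: eventually_nhds_metric)
  then have "y + (e / 2) *\<^sub>R x \<in> interior V" "0 < e / 2"
    by (auto simp: dist_real_def)
  then show ?thesis
    using that interior_subset by blast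
qed

text \<open>The set is the preimage of \<open>V\<close> under a continuous map taking
  \<open>x\<close> to 0. Reflection is the case \<open>c = - 1\<close>; large \<open>c\<close>
  yields small neighbourhoods of \<open>x\<close>.\<close>

lemma interior_translation_scaling:
  fixes V :: "'a::real_topological_vector set"
  assumes "0 \<in> interior V" "c \<noteq> 0"
  shows "x \<in> interior {y. c *\<^sub>R (y - x) \<in> V}"
proof (rule interiorI)
  have "continuous_on UNIV (\<lambda>y. c *\<^sub>R (y - x))"
    by (rule continuous_on_compose2[OF continuous_on_scaleR_right])
      (auto intro!: continuous_intros)
  then have "open ((\<lambda>y. c *\<^sub>R (y - x)) -` interior V)"
    by (rule open_vimage[OF open_interior])
  then show "open {y. c *\<^sub>R (y - x) \<in> interior V}"
    by (simp add: vimage_def)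
qed (use assms interior_subset in auto)

lemma locally_convex_symmetric:
  fixes V :: "'a::real_topological_vector set"
  assumes "locally_convex TYPE('a)" "0 \<in> interior V"
  obtains C where "convex C" "0 \<in> interior C" "C \<subseteq> V" "\<And>x. x \<in> C \<Longrightarrow> - x \<in> C"
proof -
  obtain D where D: "convex D" "0 \<in> interior D" "D \<subseteq> V"
    using assms by (auto simp: locally_convex_def)
  have "{y. - 1 *\<^sub>R (y - 0) \<in> D} = uminus ` D"
    by force
  then have "0 \<in> interior (uminus ` D)"
    using interior_translation_scaling[OF D(2), of "- 1" 0] by simp
  then have "0 \<in> interior (D \<inter> uminus ` D)"
    using D by simp
  moreover have "convex (D \<inter> uminus ` D)"
    using D(1) by (intro convex_Int convex_negations)
  ultimately show ?thesis
    using D(3) by (intro that[of "D \<inter> uminus ` D"]) auto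
qed

section \<open>Gauges of symmetric convex neighbourhoods of zero\<close>

definition minkowski :: "'a::real_vector set \<Rightarrow> 'a \<Rightarrow> real" where
  "minkowski C x = Inf {t. 0 < t \<and> (1 / t) *\<^sub>R x \<in> C}"

locale symmetric_convex_nbhd =
  fixes C :: "'a::real_topological_vector set"
  assumes convex: "convex C" and nbhd: "0 \<in> interior C" and sym: "\<And>x. x \<in> C \<Longrightarrow> - x \<in> C"
begin

lemma zero_mem: "0 \<in> C"
  using nbhd interior_subset by blast

lemma shrink: "x \<in> C \<Longrightarrow> 0 \<le> t \<Longrightarrow> t \<le> 1 \<Longrightarrow> t *\<^sub>R x \<in> C"
  using convexD[OF convex zero_mem, of x "1 - t" t] by simp

lemma absorbing: "{t. 0 < t \<and> (1 / t) *\<^sub>R x \<in> C} \<noteq> {}"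
proof -
  obtain t where "0 < t" "0 + t *\<^sub>R x \<in> C"
    using small_multiple[OF nbhd] .
  then have "1 / t \<in> {t. 0 < t \<and> (1 / t) *\<^sub>R x \<in> C}"
    by simp
  then show ?thesis
    by blast
qed

lemma minkowski_le: "0 < t \<Longrightarrow> (1 / t) *\<^sub>R x \<in> C \<Longrightarrow> minkowski C x \<le> t"
  unfolding minkowski_def by (rule cInf_lower) (auto intro!: bdd_belowI[of _ 0])

lemma minkowski_nonneg: "0 \<le> minkowski C x"
  unfolding minkowski_def by (rule cInf_greatest[OF absorbing]) auto

text \<open>The infimum need not be attained, so membership is recovered only strictly above it:
  some \<open>s < t\<close> is admissible, and shrinking \<open>(1 / s) *\<^sub>R x\<close> towards
  0 by \<open>s / t\<close> stays in \<open>C\<close>.\<close>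

lemma minkowski_less:
  assumes "minkowski C x < t"
  shows "0 < t" "(1 / t) *\<^sub>R x \<in> C"
proof -
  obtain s where s: "0 < s" "s < t" "(1 / s) *\<^sub>R x \<in> C"
    using cInf_lessD[OF absorbing] assms unfolding minkowski_def by blast
  then show "0 < t"
    by simp
  have "(s / t) *\<^sub>R ((1 / s) *\<^sub>R x) \<in> C"
    by (rule shrink[OF s(3)]) (use s in auto)
  then show "(1 / t) *\<^sub>R x \<in> C"
    using s by simp
qed

lemma minkowski_sym: "minkowski C (- x) = minkowski C x"
proof -
  have "(1 / t) *\<^sub>R (- x) \<in> C \<longleftrightarrow> (1 / t) *\<^sub>R x \<in> C" for t
    using sym[of "(1 / t) *\<^sub>R x"] sym[of "- ((1 / t) *\<^sub>R x)"] by auto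
  then show ?thesis
    by (simp add: minkowski_def)
qed

lemma sublinear_minkowski: "sublinear (minkowski C)"
proof (rule sublinearI)
  fix x y
  show "minkowski C (x + y) \<le> minkowski C x + minkowski C y"
  proof (rule field_le_epsilon)
    fix e :: real
    assume "e > 0"
    define s t where "s = minkowski C x + e / 2" and "t = minkowski C y + e / 2"
    have s: "0 < s" "(1 / s) *\<^sub>R x \<in> C" and t: "0 < t" "(1 / t) *\<^sub>R y \<in> C"
      using minkowski_less[of x s] minkowski_less[of y t] \<open>e > 0\<close> by (simp_all add: s_def t_def)
    \<comment> \<open>This convex combination of the rescaled \<open>x\<close> and \<open>y\<close>
      equals \<open>(1 / (s + t)) *\<^sub>R (x + y)\<close>.\<close>
    have "(s / (s + t)) *\<^sub>R ((1 / s) *\<^sub>R x) + (t / (s + t)) *\<^sub>R ((1 / t) *\<^sub>R y) \<in> C"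
      using s t by (intro convexD[OF convex]) (auto simp: add_divide_distrib[symmetric])
    then have "(1 / (s + t)) *\<^sub>R (x + y) \<in> C"
      using s t by (simp add: scaleR_add_right)
    then have "minkowski C (x + y) \<le> s + t"
      using s t by (intro minkowski_le) auto
    then show "minkowski C (x + y) \<le> minkowski C x + minkowski C y + e"
      by (simp add: s_def t_def)
  qed
next
  fix c :: real and x
  assume c: "0 < c"
  have "minkowski C (c *\<^sub>R x) / c \<le> minkowski C x"
  proof (rule dense_ge)
    fix t
    assume "minkowski C x < t"
    then have "0 < t" "(1 / (c * t)) *\<^sub>R (c *\<^sub>R x) \<in> C"
      using minkowski_less[of x t] c by auto
    then have "minkowski C (c *\<^sub>R x) \<le> c * t"
      using c by (intro minkowski_le) auto
    then show "minkowski C (c *\<^sub>R x) / c \<le> t"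
      using c by (simp add: field_simps)
  qed
  then show "minkowski C (c *\<^sub>R x) \<le> c * minkowski C x"
    using c by (simp add: field_simps)
next
  have "minkowski C 0 \<le> t" if "0 < t" for t
    using that zero_mem by (intro minkowski_le) auto
  then show "minkowski C 0 = 0"
    by (intro antisym minkowski_nonneg) (rule dense_ge)
qed

lemma minkowski_scaleR: "minkowski C (c *\<^sub>R x) = \<bar>c\<bar> * minkowski C x"
proof (cases "0 \<le> c")
  case False
  then show ?thesis
    using minkowski_sym[of "c *\<^sub>R x"] sublinear_scaleR[OF sublinear_minkowski, of "- c" x] by simp
qed (simp add: sublinear_scaleR[OF sublinear_minkowski])

lemma minkowski_ball_nbhd:
  assumes "0 < e"
  shows "x \<in> interior {y. minkowski C (y - x) < e}"
proof -
  \<comment> \<open>The factor 2 buys strictness: the gauge is at most \<open>e / 2\<close>.\<close>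
  have "minkowski C (y - x) < e" if "(2 / e) *\<^sub>R (y - x) \<in> C" for y
    using minkowski_le[of "e / 2" "y - x"] that assms by simp
  then show ?thesis
    using interior_translation_scaling[OF nbhd, of "2 / e" x] assms
      interior_mono[of "{y. (2 / e) *\<^sub>R (y - x) \<in> C}" "{y. minkowski C (y - x) < e}"] by auto
qed

text \<open>Domination by the gauge makes \<open>f\<close> continuous, so the kernel is closed. It
  has no interior point, since a small step in direction \<open>v\<close> changes the value of
  \<open>f\<close>.\<close>

lemma nowhere_dense_kernel:
  assumes f: "linear f" and le: "\<And>x. \<bar>f x\<bar> \<le> minkowski C x" and "f v \<noteq> 0"
  shows "nowhere_dense {x. f x = 0}"
proof -
  have "open (- {x. f x = 0})"
  proof (subst open_subopen, intro ballI)
    fix x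
    assume x: "x \<in> - {x. f x = 0}"
    have "{y. minkowski C (y - x) < \<bar>f x\<bar>} \<subseteq> - {x. f x = 0}"
    proof (intro subsetI ComplI)
      fix y
      assume "y \<in> {y. minkowski C (y - x) < \<bar>f x\<bar>}" "y \<in> {x. f x = 0}"
      then show False
        using le[of "y - x"] linear_diff[OF f, of y x] by simp
    qed
    moreover have "x \<in> interior {y. minkowski C (y - x) < \<bar>f x\<bar>}"
      using x by (intro minkowski_ball_nbhd) simp
    ultimately show "\<exists>T. open T \<and> x \<in> T \<and> T \<subseteq> - {x. f x = 0}"
      using interior_subset by (intro exI[of _ "interior {y. minkowski C (y - x) < \<bar>f x\<bar>}"]) blast
  qed
  then have "closed {x. f x = 0}"
    by (simp add: closed_def)
  moreover have "y \<notin> interior {x. f x = 0}" for y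
  proof
    assume y: "y \<in> interior {x. f x = 0}"
    then obtain t where t: "0 < t" "f (y + t *\<^sub>R v) = 0"
      using small_multiple[of y "{x. f x = 0}" v] by blast
    have "f y = 0"
      using y interior_subset by blast
    then show False
      using t \<open>f v \<noteq> 0\<close> by (simp add: linear_add[OF f] linear_scale[OF f])
  qed
  ultimately show ?thesis
    by (auto simp: nowhere_dense_def)
qed

end

section \<open>Normability and bounded neighbourhoods\<close>

text \<open>The hypothesis says that \<open>V\<close> is bounded, so this is Kolmogorov's normability criterion.\<close>

lemma normable_if_bounded_nbhd:
  fixes V :: "'a::{real_topological_vector, t2_space} set"
  assumes lc: "locally_convex TYPE('a)" and "symmetric_convex_nbhd V"
    and bdd: "\<And>C :: 'a set. symmetric_convex_nbhd C \<Longrightarrow> \<exists>M. \<forall>v\<in>V. minkowski C v \<le> M"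
  shows "normable TYPE('a)"
proof -
  interpret V: symmetric_convex_nbhd V
    by fact
  let ?N = "minkowski V"
  have small: "\<exists>e>0. \<forall>y. ?N y < e \<longrightarrow> y \<in> W" if W: "0 \<in> interior W" for W
  proof -
    obtain C where "convex C" "0 \<in> interior C" and CW: "C \<subseteq> W" and "\<And>x. x \<in> C \<Longrightarrow> - x \<in> C"
      using locally_convex_symmetric[OF lc W] by blast
    then interpret C: symmetric_convex_nbhd C
      by unfold_locales
    obtain M where M: "\<And>v. v \<in> V \<Longrightarrow> minkowski C v \<le> M"
      using bdd[OF C.symmetric_convex_nbhd_axioms] by blast
    have M0: "0 \<le> M"
      using M[OF V.zero_mem] C.minkowski_nonneg[of 0] by linarith
    show ?thesis
    \<comment> \<open>If the gauge of \<open>V\<close> at \<open>y\<close> is below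
      \<open>1 / (M + 1)\<close>, then \<open>(M + 1) *\<^sub>R y\<close> lies in \<open>V\<close>,
      so the gauge of \<open>C\<close> at \<open>y\<close> is at most \<open>M / (M + 1)\<close>.
      Using \<open>M + 1\<close> keeps this strictly below 1, which puts \<open>y\<close> in
      \<open>C\<close>.\<close>
    proof (intro exI[of _ "1 / (M + 1)"] conjI allI impI)
      fix y
      assume "?N y < 1 / (M + 1)"
      then have "(M + 1) *\<^sub>R y \<in> V"
        using V.minkowski_less(2)[of y "1 / (M + 1)"] by simp
      then have "(M + 1) * minkowski C y \<le> M"
        using M C.minkowski_scaleR[of "M + 1" y] M0 by fastforce
      then have "minkowski C y \<le> M / (M + 1)"
        using M0 by (simp add: field_simps)
      also have "\<dots> < 1"
        using M0 by simp
      finally have "minkowski C y < 1" .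
      then show "y \<in> W"
        using C.minkowski_less(2)[of y 1] CW by auto
    qed (use M0 in simp)
  qed
  have "is_norm ?N"
    unfolding is_norm_def
  proof (intro conjI allI iffI)
    fix x
    assume N0: "?N x = 0"
    show "x = 0"
    proof (rule ccontr)
      assume "x \<noteq> 0"
      \<comment> \<open>Definiteness of the norm comes from separation: a neighbourhood of 0 missing
        \<open>x\<close> contains a ball of \<open>?N\<close>.\<close>
      then obtain W where "open W" "0 \<in> W" "x \<notin> W"
        by (metis t1_space)
      then show False
        using small[of W] N0 by (auto simp: interior_open)
    qed
  qed (auto simp: V.minkowski_nonneg V.minkowski_scaleR sublinear_zero[OF V.sublinear_minkowski]
      intro: sublinear_add[OF V.sublinear_minkowski])
  moreover have "open S \<longleftrightarrow> (\<forall>x\<in>S. \<exists>e>0. \<forall>y. ?N (y - x) < e \<longrightarrow> y \<in> S)" for S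
  proof
    assume S: "open S"
    show "\<forall>x\<in>S. \<exists>e>0. \<forall>y. ?N (y - x) < e \<longrightarrow> y \<in> S"
    proof
      fix x
      assume "x \<in> S"
      moreover have "open ((\<lambda>y. y + x) -` S)"
        by (rule open_vimage[OF S]) (intro continuous_intros)
      ultimately have "0 \<in> interior ((\<lambda>y. y + x) -` S)"
        by (simp add: interior_open)
      then obtain e where "e > 0" "\<And>y. ?N y < e \<Longrightarrow> y + x \<in> S"
        using small by force
      then show "\<exists>e>0. \<forall>y. ?N (y - x) < e \<longrightarrow> y \<in> S"
        by (metis diff_add_cancel)
    qed
  next
    assume S: "\<forall>x\<in>S. \<exists>e>0. \<forall>y. ?N (y - x) < e \<longrightarrow> y \<in> S"
    have "x \<in> interior S" if x: "x \<in> S" for x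
    proof -
      obtain e where "e > 0" and e: "\<forall>y. ?N (y - x) < e \<longrightarrow> y \<in> S"
        using bspec[OF S x] by blast
      have "{y. ?N (y - x) < e} \<subseteq> S"
        using e by auto
      then show ?thesis
        using V.minkowski_ball_nbhd[OF \<open>e > 0\<close>, of x] interior_mono by blast
    qed
    then have "interior S = S"
      by (intro subset_antisym interior_subset subsetI)
    then show "open S"
      by (metis open_interior)
  qed
  ultimately show ?thesis
    unfolding normable_def by blast
qed

lemma not_normable_imp_subspace:
  fixes W :: "'a::{real_topological_vector, t2_space} set"
  assumes lc: "locally_convex TYPE('a)" and nn: "\<not> normable TYPE('a)" and W: "0 \<in> interior W"
  shows "\<exists>L. nowhere_dense L \<and> subspace L \<and> L + W = UNIV"
proof -
  obtain V where "convex V" "0 \<in> interior V" and VW: "V \<subseteq> W" and "\<And>x. x \<in> V \<Longrightarrow> - x \<in> V"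
    using locally_convex_symmetric[OF lc W] by blast
  then interpret V: symmetric_convex_nbhd V
    by unfold_locales
  \<comment> \<open>Failure of the boundedness criterion for \<open>V\<close> yields a second
    neighbourhood \<open>C\<close> whose gauge is unbounded on \<open>V\<close>; this gauge will
    dominate \<open>f\<close>.\<close>
  obtain C :: "'a set" where "symmetric_convex_nbhd C"
    and unbdd: "\<And>M. \<exists>v\<in>V. M < minkowski C v"
    using normable_if_bounded_nbhd[OF lc V.symmetric_convex_nbhd_axioms] nn by (meson not_le)
  then interpret C: symmetric_convex_nbhd C
    by simp
  obtain f where f: "linear f" and le: "\<And>x. \<bar>f x\<bar> \<le> minkowski C x"
    and fV: "\<And>M. \<exists>v\<in>V. M < \<bar>f v\<bar>"
    using unbounded_functional[OF C.sublinear_minkowski C.minkowski_sym unbdd] by blast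
  have "nowhere_dense {x. f x = 0}"
    using fV[of 0] C.nowhere_dense_kernel[OF f le] by auto
  moreover have "subspace {x. f x = 0}"
    by (rule linear_subspace_kernel[OF f])
  moreover have "x \<in> {x. f x = 0} + W" for x
  proof -
    obtain u where u: "u \<in> V" "\<bar>f x\<bar> < \<bar>f u\<bar>"
      using fV by blast
    \<comment> \<open>The multiple of \<open>u\<close> with \<open>f v = f x\<close>. Its factor has
      absolute value below 1, so \<open>v\<close> stays in \<open>V\<close>, with symmetry covering
      the negative sign.\<close>
    define v where "v = (f x / f u) *\<^sub>R u"
    have "\<bar>f x / f u\<bar> *\<^sub>R u \<in> V"
      using u by (intro V.shrink) (auto simp: abs_divide)
    then have "v \<in> V"
      unfolding v_def using V.sym[of "\<bar>f x / f u\<bar> *\<^sub>R u"]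
      by (cases "f x / f u \<ge> 0") (simp_all del: abs_divide)
    moreover have "f (x - v) = 0"
      using u by (simp add: v_def linear_diff[OF f] linear_scale[OF f])
    ultimately have "(x - v) + v \<in> {x. f x = 0} + W"
      using VW by (intro set_plus_intro) auto
    then show ?thesis
      by simp
  qed
  ultimately show ?thesis
    by blast
qed

section \<open>Cancellation in normed spaces\<close>

text \<open>Iterating \<open>y + b\<^sub>n = a\<^sub>n + b\<^sub>n\<^sub>+\<^sub>1\<close> from \<open>b\<^sub>0 = 0\<close> gives averages of the \<open>a\<^sub>n\<close> within
  \<open>s / n\<close> of \<open>y\<close>.\<close>

lemma convex_cancellation:
  assumes N: "is_norm N" and A: "convex A" and "0 < s" "0 < e"
    and cover: "\<And>b. N b < s \<Longrightarrow> \<exists>a\<in>A. N (y + b - a) < s"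
  shows "\<exists>a\<in>A. N (a - y) < e"
proof -
  have N0: "N 0 = 0" and Nscale: "\<And>c x. N (c *\<^sub>R x) = \<bar>c\<bar> * N x"
    using N by (auto simp: is_norm_def)
  obtain h where h: "\<And>b. N b < s \<Longrightarrow> h b \<in> A" "\<And>b. N b < s \<Longrightarrow> N (y + b - h b) < s"
    using cover by metis
  define b where "b n = ((\<lambda>b. y + b - h b) ^^ n) 0" for n
  have b: "N (b n) < s" for n
    by (induction n) (use \<open>0 < s\<close> N0 h(2) in \<open>auto simp: b_def\<close>)
  \<comment> \<open>The recursion telescopes, so the average of the points \<open>h (b i)\<close>
    misses \<open>y\<close> by exactly \<open>b n / n\<close>; any \<open>n\<close> above
    \<open>s / e\<close> makes this error smaller than \<open>e\<close>.\<close>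
  have sum: "(\<Sum>i<n. h (b i)) = real n *\<^sub>R y - b n" for n
  proof (induction n)
    case (Suc n)
    have "b (Suc n) = y + b n - h (b n)"
      by (simp add: b_def)
    with Suc show ?case
      by (simp add: scaleR_add_left)
  qed (simp add: b_def)
  obtain n where n: "s / e < real n"
    using reals_Archimedean2 by blast
  then have n0: "0 < n"
    using \<open>0 < s\<close> \<open>0 < e\<close> by (cases n) (auto simp: divide_less_0_iff not_less)
  have "(\<Sum>i<n. (1 / real n) *\<^sub>R h (b i)) \<in> A"
    using n0 h(1) b by (intro convex_sum[OF _ A]) auto
  moreover have "(\<Sum>i<n. (1 / real n) *\<^sub>R h (b i)) - y = (- 1 / real n) *\<^sub>R b n"
    using n0 by (simp add: sum scaleR_sum_right[symmetric] scaleR_diff_right)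
  moreover have "N ((- 1 / real n) *\<^sub>R b n) < e"
    unfolding Nscale using b[of n] n n0 \<open>0 < e\<close> by (simp add: field_simps)
  ultimately show ?thesis
    by metis
qed

lemma normable_imp_nowhere_dense_Inter:
  fixes U :: "nat \<Rightarrow> 'a::real_topological_vector set"
  assumes "normable TYPE('a)" and U: "zero_nhd_base U"
    and A: "\<And>n. nowhere_dense (A n)" "\<And>n. convex (A n)"
  shows "nowhere_dense (\<Inter>n. A n + U n)"
proof (rule ccontr)
  obtain N :: "'a \<Rightarrow> real" where N: "is_norm N"
    and op: "\<And>S. open S \<longleftrightarrow> (\<forall>x\<in>S. \<exists>e>0. \<forall>y. N (y - x) < e \<longrightarrow> y \<in> S)"
    using assms(1) unfolding normable_def by blast
  have N0: "N 0 = 0" and Nadd: "\<And>x y. N (x + y) \<le> N x + N y"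
    using N by (auto simp: is_norm_def)
  have "N ((- 1) *\<^sub>R x) = \<bar>- 1\<bar> * N x" for x
    using N unfolding is_norm_def by blast
  then have Nminus: "N (- x) = N x" for x
    by simp
  have Ntri: "N (x - z) \<le> N (x - y) + N (y - z)" for x y z
    using Nadd[of "x - y" "y - z"] by simp
  have ball: "open {y. N (y - x) < e}" for x e
    unfolding op
  proof
    fix y
    assume "y \<in> {y. N (y - x) < e}"
    moreover have "N (z - x) < e" if "N (z - y) < e - N (y - x)" for z
      using Ntri[of z x y] that by linarith
    ultimately show "\<exists>d>0. \<forall>z. N (z - y) < d \<longrightarrow> z \<in> {y. N (y - x) < e}"
      by (intro exI[of _ "e - N (y - x)"]) auto
  qed
  assume "\<not> nowhere_dense (\<Inter>n. A n + U n)"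
  then obtain x where "x \<in> interior (closure (\<Inter>n. A n + U n))"
    by (auto simp: nowhere_dense_def)
  then obtain r where r: "r > 0"
    and dense: "\<And>z. N (z - x) < r \<Longrightarrow> z \<in> closure (\<Inter>n. A n + U n)"
    using op[of "interior (closure (\<Inter>n. A n + U n))"] interior_subset
    by (meson open_interior subsetD)
  have "0 \<in> interior {y. N (y - 0) < r / 3}"
    using ball[of 0 "r / 3"] r by (simp add: interior_open N0)
  then obtain n where n: "U n \<subseteq> {y. N (y - 0) < r / 3}"
    using U unfolding zero_nhd_base_def by blast
  have "y \<in> closure (A n)" if y: "N (y - x) < r / 3" for y
  proof -
    \<comment> \<open>The radii are chosen so that \<open>r / 3 + 2 * r / 3 = r\<close> keeps
      \<open>y + b\<close> in the ball where the intersection is dense, while the density error and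
      the element of \<open>U n\<close>, each below \<open>r / 3\<close>, add up to the same
      \<open>2 * r / 3\<close> that bounds \<open>b\<close>. Cancellation needs this match.\<close>
    have "\<exists>a\<in>A n. N (y + b - a) < 2 * r / 3" if b: "N b < 2 * r / 3" for b
    proof -
      have "N (y + b - x) < r"
        using Nadd[of "y - x" b] y b by (simp add: algebra_simps)
      then have "y + b \<in> closure (\<Inter>n. A n + U n)"
        by (rule dense)
      moreover have "y + b \<in> {z. N (z - (y + b)) < r / 3}"
        using r by (simp add: N0)
      ultimately have "{z. N (z - (y + b)) < r / 3} \<inter> (\<Inter>n. A n + U n) \<noteq> {}"
        using open_Int_closure_eq_empty[OF ball] by blast
      then obtain z where z: "N (z - (y + b)) < r / 3" "z \<in> A n + U n"
        by blast
      then obtain a u where a: "a \<in> A n" "u \<in> U n" "z = a + u"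
        by (auto elim: set_plus_elim)
      then have "N (z - a) < r / 3"
        using n by auto
      then have "N (y + b - a) < 2 * r / 3"
        using Ntri[of "y + b" a z] z(1) Nminus[of "z - (y + b)"] by simp
      then show ?thesis
        using a(1) by blast
    qed
    then have approx: "\<exists>a\<in>A n. N (a - y) < e" if "e > 0" for e
      using convex_cancellation[OF N A(2)[of n], of "2 * r / 3" e y] r that by simp
    show ?thesis
      unfolding closure_iff_nhds_not_empty
    proof (intro allI impI)
      fix S V
      assume "V \<subseteq> S" "open V" "y \<in> V"
      then obtain e where "e > 0" "\<And>z. N (z - y) < e \<Longrightarrow> z \<in> V"
        using op by blast
      with approx[of e] \<open>V \<subseteq> S\<close> show "A n \<inter> S \<noteq> {}"
        by blast
    qed
  qed
  then have "{y. N (y - x) < r / 3} \<subseteq> interior (closure (A n))"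
    by (intro interior_maximal ball) auto
  then have "x \<in> interior (closure (A n))"
    using r by (auto simp: N0)
  then show False
    using A(1)[of n] by (simp add: nowhere_dense_def)
qed

section \<open>Equivalence of normability with the two intersection conditions\<close>

theorem theorem2:
  fixes U :: "nat \<Rightarrow> 'a::{real_topological_vector, t2_space} set"
  assumes "locally_convex TYPE('a)"
    and "zero_nhd_base U"
  shows "(normable TYPE('a) \<longleftrightarrow>
            (\<forall>A :: nat \<Rightarrow> 'a set. (\<forall>n. nowhere_dense (A n) \<and> convex (A n)) \<longrightarrow>
               nowhere_dense (\<Inter>n. A n + U n)))
       \<and> (normable TYPE('a) \<longleftrightarrow>
            (\<forall>L :: nat \<Rightarrow> 'a set. (\<forall>n. nowhere_dense (L n) \<and> subspace (L n)) \<longrightarrow>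
               (\<Inter>n. L n + U n) \<noteq> UNIV))"
    (is "(_ \<longleftrightarrow> ?convex) \<and> (_ \<longleftrightarrow> ?linear)")
proof -
  \<comment> \<open>The implications are proved in a cycle: normability gives the convex condition,
    that gives the linear one, and the linear one gives normability.\<close>
  have "?convex" if "normable TYPE('a)"
    using normable_imp_nowhere_dense_Inter[OF that assms(2)] by blast
  moreover have "?linear" if ?convex
  proof (intro allI impI notI)
    fix L :: "nat \<Rightarrow> 'a set"
    assume L: "\<forall>n. nowhere_dense (L n) \<and> subspace (L n)" and eq: "(\<Inter>n. L n + U n) = UNIV"
    have "nowhere_dense (\<Inter>n. L n + U n)"
      using that L subspace_imp_convex by blast
    then show False
      unfolding eq by (simp add: nowhere_dense_def)
  qed
  moreover have "normable TYPE('a)" if ?linear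
  proof (rule ccontr)
    assume nn: "\<not> normable TYPE('a)"
    have "\<exists>L. nowhere_dense L \<and> subspace L \<and> L + U n = UNIV" for n
      using not_normable_imp_subspace[OF assms(1) nn] assms(2) by (simp add: zero_nhd_base_def)
    then obtain L where "\<And>n. nowhere_dense (L n) \<and> subspace (L n) \<and> L n + U n = UNIV"
      by metis
    then have "(\<forall>n. nowhere_dense (L n) \<and> subspace (L n)) \<and> (\<Inter>n. L n + U n) = UNIV"
      by auto
    with that show False
      by blast
  qed
  ultimately show ?thesis
    by blast
qed

end
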